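(* Let $G=(V,E)$ be a connected graph on $n$ vertices with maximum degree $\Delta(G)$, and let $k,s$ be integers with $1\le s\le k$. If $k<\Delta(G)$, then the supertoken graphs $F_k^s(G)$ and $F_{k\times 1}^s(G)$ are both connected. Moreover, if $\Delta(G)\le k\le n$ and $(k,s)\neq(n,1)$, then the supertoken graph $F_k^s(G)$ is connected.
   Context: Graphs are finite, simple and undirected. Let $G=(V,E)$ be a graph and let $1\le s\le k$ be integers. $F_k^s(G)$ (indistinguishable tokens): its vertices are the multisets of $k$ elements of $V$ in which every vertex of $G$ has multiplicity at most $s$ (i.e. the distributions of $k$ identical tokens on the vertices of $G$ with at most $s$ tokens per vertex). Two such multisets are adjacent if one is obtained from the other by replacing one occurrence of a vertex $u$ by a vertex $v$ with $uv\in E$ (i.e. by moving one token along an edge of $G$). $F_{k\times 1}^s(G)$ (pairwise different tokens): its vertices are the ordered $k$-tuples $(\alpha_1,\ldots,\alpha_k)\in V^k$ in which every vertex of $G$ occurs at most $s$ times ($\alpha_i$ is the position of token $i$). Two such tuples are adjacent if they differ in exactly one coordinate $i$, and the two entries in coordinate $i$ are adjacent in $G$. *)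

theory Defs
  imports "HOL-Library.Multiset" "Graph_Theory.Pair_Digraph" "Graph_Theory.Digraph_Component"
begin

text \<open>
  Finite simple undirected graphs are modelled as in the session Graph_Theory, by the locale
  \<^locale>\<open>pair_graph\<close>: finite vertex set, symmetric irreflexive arc relation, so an edge
  \<open>uv\<close> is represented by the two arcs \<open>(u,v)\<close> and \<open>(v,u)\<close>. The lemmas at the end show that
  the supertoken graphs are again graphs of this kind.
\<close>

text \<open>By symmetry, the out-degree counts the neighbours of a vertex.\<close>

definition max_degree :: "'a pair_pre_digraph \<Rightarrow> nat" where
  "max_degree G = Max (out_degree (with_proj G) ` pverts G)"

definition supertoken_verts :: "nat \<Rightarrow> nat \<Rightarrow> 'a pair_pre_digraph \<Rightarrow> 'a multiset set" where
  "supertoken_verts k s G =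
     {A. size A = k \<and> set_mset A \<subseteq> pverts G \<and> (\<forall>v\<in>pverts G. count A v \<le> s)}"

definition supertoken_graph :: "nat \<Rightarrow> nat \<Rightarrow> 'a pair_pre_digraph \<Rightarrow> 'a multiset pair_pre_digraph" where
  "supertoken_graph k s G =
     \<lparr> pverts = supertoken_verts k s G,
       parcs = {(A, B). A \<in> supertoken_verts k s G \<and> B \<in> supertoken_verts k s G \<and>
                  (\<exists>u v. (u, v) \<in> parcs G \<and> u \<in># A \<and> B = A - {#u#} + {#v#})} \<rparr>"

text \<open>A tuple \<open>(\<alpha>\<^sub>1, \<dots>, \<alpha>\<^sub>k)\<close> is a list of length \<open>k\<close>, indexed from 0.\<close>

definition labelled_supertoken_verts :: "nat \<Rightarrow> nat \<Rightarrow> 'a pair_pre_digraph \<Rightarrow> 'a list set" where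
  "labelled_supertoken_verts k s G =
     {\<alpha>. length \<alpha> = k \<and> set \<alpha> \<subseteq> pverts G \<and> (\<forall>v\<in>pverts G. card {i. i < k \<and> \<alpha> ! i = v} \<le> s)}"

definition labelled_supertoken_graph :: "nat \<Rightarrow> nat \<Rightarrow> 'a pair_pre_digraph \<Rightarrow> 'a list pair_pre_digraph" where
  "labelled_supertoken_graph k s G =
     \<lparr> pverts = labelled_supertoken_verts k s G,
       parcs = {(\<alpha>, \<beta>). \<alpha> \<in> labelled_supertoken_verts k s G \<and> \<beta> \<in> labelled_supertoken_verts k s G \<and>
                  (\<exists>i<k. (\<alpha> ! i, \<beta> ! i) \<in> parcs G \<and> (\<forall>j<k. j \<noteq> i \<longrightarrow> \<alpha> ! j = \<beta> ! j))} \<rparr>"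

lemma finite_supertoken_verts:
  assumes "finite (pverts G)"
  shows "finite (supertoken_verts k s G)"
proof -
  have "supertoken_verts k s G \<subseteq> mset ` {xs. set xs \<subseteq> pverts G \<and> length xs = k}"
  proof
    fix A assume A: "A \<in> supertoken_verts k s G"
    obtain xs where "mset xs = A" using ex_mset by blast
    with A show "A \<in> mset ` {xs. set xs \<subseteq> pverts G \<and> length xs = k}"
      by (auto simp: supertoken_verts_def)
  qed
  with finite_lists_length_eq[OF assms] show ?thesis
    by (meson finite_imageI finite_subset)
qed

lemma finite_labelled_supertoken_verts:
  assumes "finite (pverts G)"
  shows "finite (labelled_supertoken_verts k s G)"
  by (rule finite_subset[OF _ finite_lists_length_eq[OF assms, of k]])
    (auto simp: labelled_supertoken_verts_def)

lemma pair_graph_supertoken_graph: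
  assumes "pair_graph G"
  shows "pair_graph (supertoken_graph k s G)"
proof -
  interpret pair_graph G by fact
  let ?V = "supertoken_verts k s G"
  have fin: "finite ?V" using pair_finite_verts by (rule finite_supertoken_verts)
  have arcs: "parcs (supertoken_graph k s G) \<subseteq> ?V \<times> ?V"
    by (auto simp: supertoken_graph_def)
  show ?thesis
  proof
    show "fst e \<in> pverts (supertoken_graph k s G)" "snd e \<in> pverts (supertoken_graph k s G)"
      if "e \<in> parcs (supertoken_graph k s G)" for e
      using that by (auto simp: supertoken_graph_def)
    show "finite (pverts (supertoken_graph k s G))"
      using fin by (simp add: supertoken_graph_def)
    show "finite (parcs (supertoken_graph k s G))"
      using finite_subset[OF arcs] fin by blast
    show "fst e \<noteq> snd e" if "e \<in> parcs (supertoken_graph k s G)" for e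
    proof
      assume "fst e = snd e"
      with that obtain A u v where "(u, v) \<in> parcs G" "u \<in># A" "A = A - {#u#} + {#v#}"
        by (auto simp: supertoken_graph_def)
      then have "u = v"
        by (metis add_mset_add_single add_right_imp_eq insert_DiffM2 single_eq_single add_left_imp_eq)
      with \<open>(u, v) \<in> parcs G\<close> no_loops' show False by blast
    qed
    have "(B, A) \<in> parcs (supertoken_graph k s G)"
      if AB: "(A, B) \<in> parcs (supertoken_graph k s G)" for A B
    proof -
      from AB obtain u v where "(u, v) \<in> parcs G" "u \<in># A" and B: "B = A - {#u#} + {#v#}"
        and V: "A \<in> ?V" "B \<in> ?V"
        by (auto simp: supertoken_graph_def)
      then have "(v, u) \<in> parcs G" "v \<in># B" "A = B - {#v#} + {#u#}"
        using arcs_symmetric by auto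
      with V show ?thesis by (auto simp: supertoken_graph_def)
    qed
    then show "symmetric (with_proj (supertoken_graph k s G))"
      by (auto simp: symmetric_def intro: symI)
  qed
qed

lemma pair_graph_labelled_supertoken_graph:
  assumes "pair_graph G"
  shows "pair_graph (labelled_supertoken_graph k s G)"
proof -
  interpret pair_graph G by fact
  let ?V = "labelled_supertoken_verts k s G"
  have fin: "finite ?V" using pair_finite_verts by (rule finite_labelled_supertoken_verts)
  have arcs: "parcs (labelled_supertoken_graph k s G) \<subseteq> ?V \<times> ?V"
    by (auto simp: labelled_supertoken_graph_def)
  show ?thesis
  proof
    show "fst e \<in> pverts (labelled_supertoken_graph k s G)"
      "snd e \<in> pverts (labelled_supertoken_graph k s G)"
      if "e \<in> parcs (labelled_supertoken_graph k s G)" for e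
      using that by (auto simp: labelled_supertoken_graph_def)
    show "finite (pverts (labelled_supertoken_graph k s G))"
      using fin by (simp add: labelled_supertoken_graph_def)
    show "finite (parcs (labelled_supertoken_graph k s G))"
      using finite_subset[OF arcs] fin by blast
    show "fst e \<noteq> snd e" if "e \<in> parcs (labelled_supertoken_graph k s G)" for e
      using that no_loops' by (fastforce simp: labelled_supertoken_graph_def)
    have "(\<beta>, \<alpha>) \<in> parcs (labelled_supertoken_graph k s G)"
      if "(\<alpha>, \<beta>) \<in> parcs (labelled_supertoken_graph k s G)" for \<alpha> \<beta>
      using that arcs_symmetric by (fastforce simp: labelled_supertoken_graph_def)
    then show "symmetric (with_proj (labelled_supertoken_graph k s G))"
      by (auto simp: symmetric_def intro: symI)
  qed
qed

end

theory Submission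
  imports Defs "HOL-Combinatorics.Permutations"
begin

text \<open>
  For identical tokens, a token at \<open>u\<close> can be moved along a walk to any non-full vertex \<open>v\<close>: a full
  vertex met on the way first sends one of its own tokens on to \<open>v\<close> and is then refilled. Repeating
  this while two distributions differ proves \<open>F_k^s(G)\<close> connected.

  For distinct tokens and \<open>k < \<Delta>(G)\<close>, such walks lift to tuples, so every tuple reaches one that
  places the tokens on \<open>k\<close> fixed neighbours of a vertex \<open>x\<close> of maximum degree. There \<open>x\<close> and at least
  one further neighbour of \<open>x\<close> are empty, which leaves enough room to transpose any two tokens.
\<close>

text \<open>The arc relation is already symmetric, so passing to \<open>mk_symmetric\<close> changes
  no reachability. The clause \<open>pverts G \<noteq> {}\<close> is why each connectedness proof
  below also exhibits one token placement.\<close>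

lemma connected_pair_graph_iff:
  assumes "pair_graph G"
  shows "Digraph_Component.connected (with_proj G) \<longleftrightarrow>
    pverts G \<noteq> {} \<and> (\<forall>u\<in>pverts G. \<forall>v\<in>pverts G. (u, v) \<in> (parcs G)\<^sup>*)"
proof -
  interpret pair_graph G by fact
  have "u \<rightarrow>\<^sup>*\<^bsub>mk_symmetric (with_proj G)\<^esub> v \<longleftrightarrow> (u, v) \<in> (parcs G)\<^sup>*"
    if "u \<in> pverts G" "v \<in> pverts G" for u v
    using that reachable_mk_symmetric_eq[OF sym_arcs] reachable_conv by simp
  then show ?thesis
    by (auto simp: Digraph_Component.connected_def strongly_connected_def)
qed

lemma rtrancl_parcs_sym:
  assumes "pair_graph G" and "(u, v) \<in> (parcs G)\<^sup>*"
  shows "(v, u) \<in> (parcs G)\<^sup>*"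
proof -
  interpret pair_graph G by fact
  have "sym (parcs G)" using sym_arcs by (simp add: symmetric_def)
  then show ?thesis using assms(2) by (meson sym_rtrancl symE)
qed

section \<open>Identical tokens\<close>

lemma supertoken_verts_move:
  assumes "A \<in> supertoken_verts k s G" and "u \<in># A" and "v \<in> pverts G" and "count A v < s"
  shows "A - {#u#} + {#v#} \<in> supertoken_verts k s G"
proof -
  have "set_mset (A - {#u#} + {#v#}) \<subseteq> pverts G"
    using assms by (auto simp: supertoken_verts_def dest: in_diffD)
  moreover have "size (A - {#u#} + {#v#}) = k"
    using assms by (auto simp: supertoken_verts_def size_Diff_singleton)
      (metis Suc_pred nonempty_has_size empty_iff set_mset_empty)
  moreover have "count (A - {#u#} + {#v#}) w \<le> s" if "w \<in> pverts G" for w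
    using assms that by (auto simp: supertoken_verts_def intro: le_trans[OF diff_le_self])
  ultimately show ?thesis by (simp add: supertoken_verts_def)
qed

lemma supertoken_arc:
  assumes "pair_graph G" and "A \<in> supertoken_verts k s G"
    and "(u, v) \<in> parcs G" and "u \<in># A" and "count A v < s"
  shows "(A, A - {#u#} + {#v#}) \<in> parcs (supertoken_graph k s G)"
proof -
  interpret pair_graph G by fact
  have "A - {#u#} + {#v#} \<in> supertoken_verts k s G"
    using assms in_arcsD2 by (intro supertoken_verts_move) auto
  then show ?thesis using assms by (auto simp: supertoken_graph_def)
qed

text \<open>Induction along the walk from its first arc, with \<open>A\<close> arbitrary because the
  hypothesis is applied to configurations other than the given one. Only the multiset reached
  matters, so it is irrelevant which token ends at \<open>v\<close>.\<close>

lemma supertoken_walk_move: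
  assumes G: "pair_graph G" and "(u, v) \<in> (parcs G)\<^sup>*" and "v \<in> pverts G"
    and "A \<in> supertoken_verts k s G" and "u \<in># A" and "count A v < s"
  shows "(A, A - {#u#} + {#v#}) \<in> (parcs (supertoken_graph k s G))\<^sup>*"
  using assms(2,4-6)
proof (induction arbitrary: A rule: converse_rtrancl_induct)
  case base
  then show ?case by simp
next
  case (step u w)
  interpret pair_graph G by fact
  have w: "w \<in> pverts G" and uw: "u \<noteq> w"
    using step.hyps(1) in_arcsD2 no_loops' by auto
  show ?case
  proof (cases "count A w < s")
    case True
    let ?A = "A - {#u#} + {#w#}"
    have first: "(A, ?A) \<in> parcs (supertoken_graph k s G)"
      using G step.prems(1) step.hyps(1) step.prems(2) True by (rule supertoken_arc)
    show ?thesis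
    \<comment> \<open>For \<open>w = v\<close> the arc just used finishes the job, and it may have
      filled \<open>v\<close>, so the induction hypothesis could not be applied to
      \<open>?A\<close>.\<close>
    proof (cases "w = v")
      case True
      with first show ?thesis by blast
    next
      case False
      have "?A \<in> supertoken_verts k s G"
        using step.prems(1,2) w True by (rule supertoken_verts_move)
      moreover have "count ?A v < s" using step.prems(3) False by simp
      ultimately have "(?A, ?A - {#w#} + {#v#}) \<in> (parcs (supertoken_graph k s G))\<^sup>*"
        by (intro step.IH) auto
      with first show ?thesis by (simp add: converse_rtrancl_into_rtrancl)
    qed
  next
    case False
    have wA: "w \<in># A" and wv: "w \<noteq> v"
      using False step.prems(3) by (auto simp flip: count_greater_zero_iff)
    let ?A = "A - {#w#} + {#v#}"
    \<comment> \<open>Here \<open>w\<close> is full: the induction hypothesis sends a token of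
      \<open>w\<close> on to \<open>v\<close> first, and only then does \<open>u\<close> refill
      \<open>w\<close>.\<close>
    have "(A, ?A) \<in> (parcs (supertoken_graph k s G))\<^sup>*"
      using step.prems(1) wA step.prems(3) by (rule step.IH)
    moreover have "(?A, ?A - {#u#} + {#w#}) \<in> parcs (supertoken_graph k s G)"
    proof (rule supertoken_arc[OF G _ step.hyps(1)])
      show "?A \<in> supertoken_verts k s G"
        using step.prems(1) wA \<open>v \<in> pverts G\<close> step.prems(3) by (rule supertoken_verts_move)
      show "u \<in># ?A" using step.prems(2) uw by (simp add: in_diff_count)
      have "count A w \<le> s" using step.prems(1) w by (simp add: supertoken_verts_def)
      \<comment> \<open>Subtraction is truncated; positivity makes removing a token a real decrease
        below \<open>s\<close>.\<close>
      moreover have "0 < count A w" using wA by (rule count_greater_zero_iff[THEN iffD2])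
      ultimately have "count A w - 1 < s" by linarith
      then show "count ?A w < s" using wv by simp
    qed
    moreover have "?A - {#u#} + {#w#} = A - {#u#} + {#v#}"
      using wA uw step.prems(2)
      by (auto simp: multiset_eq_iff simp flip: count_greater_zero_iff)
    ultimately show ?thesis by simp
  qed
qed

lemma multiset_same_size_neq:
  fixes A B :: "'a multiset"
  assumes "size A = size B" and "A \<noteq> B"
  obtains u where "count B u < count A u"
proof -
  have "\<not> A \<subseteq># B"
    using assms by (metis mset_subset_size subset_mset.le_neq_trans less_irrefl)
  then show thesis using that by (auto simp: subseteq_mset_def not_le)
qed

text \<open>Induction on the number of misplaced tokens, \<open>size (A - B)\<close>: each round
  carries one token from a vertex with a surplus to a vertex with a deficit. A deficit vertex is
  never full, since \<open>B\<close> respects the bound \<open>s\<close>.\<close>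

lemma supertoken_verts_reachable:
  assumes G: "pair_graph G" and conn: "Digraph_Component.connected (with_proj G)"
    and "A \<in> supertoken_verts k s G" and B: "B \<in> supertoken_verts k s G"
  shows "(A, B) \<in> (parcs (supertoken_graph k s G))\<^sup>*"
  using assms(3)
proof (induction "size (A - B)" arbitrary: A rule: less_induct)
  case less
  show ?case
  proof (cases "A = B")
    case False
    have size: "size A = size B" using less.prems B by (simp add: supertoken_verts_def)
    obtain u where u: "count B u < count A u"
      using size False by (rule multiset_same_size_neq)
    obtain v where v: "count A v < count B v"
      using multiset_same_size_neq[of B A] size False by metis
    have uA: "u \<in># A" and vB: "v \<in># B" using u v by (auto simp flip: count_greater_zero_iff)
    have uG: "u \<in> pverts G" and vG: "v \<in> pverts G"
      using uA vB less.prems B by (auto simp: supertoken_verts_def)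
    have "count B v \<le> s" using B vG by (simp add: supertoken_verts_def)
    with v have vs: "count A v < s" by simp
    have uv: "(u, v) \<in> (parcs G)\<^sup>*"
      using conn uG vG by (simp add: connected_pair_graph_iff[OF G])
    let ?A = "A - {#u#} + {#v#}"
    \<comment> \<open>Removing \<open>u\<close> lowers a surplus by one, and adding \<open>v\<close>
      only fills a deficit, so no new surplus arises.\<close>
    have "A - B = add_mset u (?A - B)"
      using u v by (auto simp: multiset_eq_iff)
    then have "size (?A - B) < size (A - B)" by simp
    moreover have "?A \<in> supertoken_verts k s G"
      using less.prems uA vG vs by (rule supertoken_verts_move)
    ultimately have "(?A, B) \<in> (parcs (supertoken_graph k s G))\<^sup>*" by (rule less.hyps)
    with supertoken_walk_move[OF G uv vG less.prems uA vs] show ?thesis by (rule rtrancl_trans)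
  qed simp
qed

lemma mset_set_in_supertoken_verts:
  assumes "finite N" and "N \<subseteq> pverts G" and "card N = k" and "1 \<le> s"
  shows "mset_set N \<in> supertoken_verts k s G"
  using assms by (auto simp: supertoken_verts_def count_mset_set')

lemma connected_supertoken_graph:
  assumes G: "pair_graph G" and conn: "Digraph_Component.connected (with_proj G)"
    and "1 \<le> s" and "k \<le> card (pverts G)"
  shows "Digraph_Component.connected (with_proj (supertoken_graph k s G))"
proof -
  interpret pair_graph G by fact
  obtain N where "N \<subseteq> pverts G" "card N = k" "finite N"
    using obtain_subset_with_card_n[OF assms(4)] by blast
  with \<open>1 \<le> s\<close> have "supertoken_verts k s G \<noteq> {}"
    using mset_set_in_supertoken_verts by blast
  then show ?thesis
    unfolding connected_pair_graph_iff[OF pair_graph_supertoken_graph[OF G]]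
    using supertoken_verts_reachable[OF G conn] by (simp add: supertoken_graph_def)
qed

section \<open>Distinct tokens\<close>

text \<open>Admissibility does not depend on which token sits where, so the multiset lemmas can be
  reused for tuples.\<close>

lemma labelled_supertoken_verts_iff:
  "\<alpha> \<in> labelled_supertoken_verts k s G \<longleftrightarrow> mset \<alpha> \<in> supertoken_verts k s G"
proof -
  have "count (mset \<alpha>) v = card {i. i < length \<alpha> \<and> \<alpha> ! i = v}" for v
    by (simp add: count_mset count_list_eq_length_filter length_filter_conv_card eq_commute)
  then show ?thesis
    by (auto simp: labelled_supertoken_verts_def supertoken_verts_def)
qed

lemma labelled_supertoken_arc:
  assumes "mset \<alpha> \<in> supertoken_verts k s G" and "mset (\<alpha>[i := v]) \<in> supertoken_verts k s G"
    and "i < k" and "(\<alpha> ! i, v) \<in> parcs G"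
  shows "(\<alpha>, \<alpha>[i := v]) \<in> parcs (labelled_supertoken_graph k s G)"
proof -
  have "length \<alpha> = k" using assms(1) by (simp add: supertoken_verts_def)
  then show ?thesis
    using assms by (auto simp: labelled_supertoken_graph_def labelled_supertoken_verts_iff)
qed

text \<open>Each move from \<open>u\<close> to \<open>v\<close> is performed by any one index
  currently at \<open>u\<close>. This fixes the final positions but not their order, which the star
  lemmas then correct.\<close>

lemma supertoken_walk_lift:
  assumes "(mset \<alpha>, B) \<in> (parcs (supertoken_graph k s G))\<^sup>*"
  obtains \<beta> where "mset \<beta> = B" "(\<alpha>, \<beta>) \<in> (parcs (labelled_supertoken_graph k s G))\<^sup>*"
proof -
  from assms have "\<exists>\<beta>. mset \<beta> = B \<and> (\<alpha>, \<beta>) \<in> (parcs (labelled_supertoken_graph k s G))\<^sup>*"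
  proof (induction rule: rtrancl_induct)
    case base
    then show ?case by blast
  next
    case (step B C)
    then obtain \<beta> where \<beta>: "mset \<beta> = B" "(\<alpha>, \<beta>) \<in> (parcs (labelled_supertoken_graph k s G))\<^sup>*"
      by blast
    from step.hyps(2) obtain u v where uv: "(u, v) \<in> parcs G" "u \<in># B" "C = B - {#u#} + {#v#}"
      and BC: "B \<in> supertoken_verts k s G" "C \<in> supertoken_verts k s G"
      by (auto simp: supertoken_graph_def)
    from uv(2) \<beta>(1) obtain i where i: "i < length \<beta>" "\<beta> ! i = u"
      by (metis in_set_conv_nth set_mset_mset)
    have C: "mset (\<beta>[i := v]) = C" using i uv \<beta>(1) by (simp add: mset_update)
    have "i < k" using i BC(1) \<beta>(1) by (auto simp: supertoken_verts_def)
    then have "(\<beta>, \<beta>[i := v]) \<in> parcs (labelled_supertoken_graph k s G)"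
      using BC \<beta>(1) C i uv by (intro labelled_supertoken_arc) auto
    with \<beta>(2) C show ?case by (metis rtrancl.rtrancl_into_rtrancl)
  qed
  then show thesis using that by blast
qed

section \<open>Rearranging tokens on the neighbours of one vertex\<close>

lemma distinct_in_supertoken_verts:
  assumes "distinct \<alpha>" and "set \<alpha> \<subseteq> pverts G" and "length \<alpha> = k" and "1 \<le> s"
  shows "mset \<alpha> \<in> supertoken_verts k s G"
  using mset_set_in_supertoken_verts[of "set \<alpha>"] assms
  by (simp add: mset_set_set distinct_card)

lemma distinct_list_update_fresh:
  assumes "distinct xs" and "y \<notin> set xs"
  shows "distinct (xs[i := y])"
  using assms by (intro distinct_list_update) auto

text \<open>Token \<open>i\<close> steps to the centre \<open>x\<close> and then to
  \<open>v\<close>. The centre is empty because there are no loops, and all positions stay distinct,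
  so the bound holds even for \<open>s = 1\<close>.\<close>

lemma star_hop:
  assumes G: "pair_graph G" and "1 \<le> s" and "i < k"
    and \<alpha>: "distinct \<alpha>" "length \<alpha> = k" "set \<alpha> \<subseteq> {y. (x, y) \<in> parcs G}"
    and v: "(x, v) \<in> parcs G" "v \<notin> set \<alpha>"
  shows "(\<alpha>, \<alpha>[i := v]) \<in> (parcs (labelled_supertoken_graph k s G))\<^sup>*"
proof -
  interpret pair_graph G by fact
  have x: "x \<in> pverts G" "x \<notin> set \<alpha>" using v in_arcsD1 \<alpha>(3) no_loops' by blast+
  have \<alpha>G: "set \<alpha> \<subseteq> pverts G" using \<alpha>(3) in_arcsD2 by blast
  have vG: "v \<in> pverts G" using v in_arcsD2 by blast
  have admissible: "mset (\<alpha>[i := y]) \<in> supertoken_verts k s G" if "y \<in> pverts G" "y \<notin> set \<alpha>" for y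
    using that \<alpha> \<alpha>G \<open>1 \<le> s\<close> set_update_subset_insert[of \<alpha> i y]
    by (intro distinct_in_supertoken_verts distinct_list_update_fresh) auto
  have "mset \<alpha> \<in> supertoken_verts k s G"
    using \<alpha> \<alpha>G \<open>1 \<le> s\<close> by (intro distinct_in_supertoken_verts)
  moreover have "(\<alpha> ! i, x) \<in> parcs G"
    using \<alpha> \<open>i < k\<close> arcs_symmetric nth_mem by blast
  ultimately have "(\<alpha>, \<alpha>[i := x]) \<in> parcs (labelled_supertoken_graph k s G)"
    using admissible x \<open>i < k\<close> by (intro labelled_supertoken_arc) auto
  moreover have "(\<alpha>[i := x], \<alpha>[i := x, i := v]) \<in> parcs (labelled_supertoken_graph k s G)"
    using admissible x v vG \<open>i < k\<close> \<alpha>(2) by (intro labelled_supertoken_arc) auto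
  ultimately show ?thesis by simp
qed

text \<open>The free leaf \<open>w\<close> serves as a buffer: \<open>i\<close> hops to
  \<open>w\<close>, \<open>j\<close> to the old place of \<open>i\<close>, and \<open>i\<close> from
  \<open>w\<close> to the old place of \<open>j\<close>.\<close>

lemma star_swap:
  assumes G: "pair_graph G" and "1 \<le> s" and i: "i < k" and j: "j < k" and "i \<noteq> j"
    and \<alpha>: "distinct \<alpha>" "length \<alpha> = k" "set \<alpha> \<subseteq> {y. (x, y) \<in> parcs G}"
    and w: "(x, w) \<in> parcs G" "w \<notin> set \<alpha>"
  shows "(\<alpha>, permute_list (Transposition.transpose i j) \<alpha>)
    \<in> (parcs (labelled_supertoken_graph k s G))\<^sup>*"
proof -
  let ?R = "(parcs (labelled_supertoken_graph k s G))\<^sup>*"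
  let ?\<beta> = "\<alpha>[i := w]"
  let ?\<gamma> = "?\<beta>[j := \<alpha> ! i]"
  have nbr: "(x, \<alpha> ! i) \<in> parcs G" "(x, \<alpha> ! j) \<in> parcs G"
    using \<alpha> i j by (auto simp: subset_iff)
  have \<beta>: "distinct ?\<beta>" "set ?\<beta> \<subseteq> {y. (x, y) \<in> parcs G}"
    using \<alpha> w set_update_subset_insert[of \<alpha> i w] by (auto intro: distinct_list_update_fresh)
  \<comment> \<open>By distinctness, moving token \<open>i\<close> really vacates its old place;
    likewise for token \<open>j\<close> below.\<close>
  have \<beta>i: "\<alpha> ! i \<notin> set ?\<beta>"
    using \<alpha> w i by (auto simp: in_set_conv_nth nth_list_update nth_eq_iff_index_eq)
  have \<gamma>: "distinct ?\<gamma>" "set ?\<gamma> \<subseteq> {y. (x, y) \<in> parcs G}"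
    using \<beta> \<beta>i nbr set_update_subset_insert[of ?\<beta> j "\<alpha> ! i"]
    by (auto intro: distinct_list_update_fresh)
  have \<gamma>j: "\<alpha> ! j \<notin> set ?\<gamma>"
    using \<alpha> w i j \<open>i \<noteq> j\<close>
    by (auto simp: in_set_conv_nth nth_list_update nth_eq_iff_index_eq)
  have "(\<alpha>, ?\<beta>) \<in> ?R" using star_hop[OF G \<open>1 \<le> s\<close> i \<alpha> w] .
  also have "(?\<beta>, ?\<gamma>) \<in> ?R"
    using \<alpha>(2) by (intro star_hop[OF G \<open>1 \<le> s\<close> j \<beta>(1) _ \<beta>(2) nbr(1) \<beta>i]) simp
  also have "(?\<gamma>, ?\<gamma>[i := \<alpha> ! j]) \<in> ?R"
    using \<alpha>(2) by (intro star_hop[OF G \<open>1 \<le> s\<close> i \<gamma>(1) _ \<gamma>(2) nbr(2) \<gamma>j]) simp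
  also have "?\<gamma>[i := \<alpha> ! j] = permute_list (Transposition.transpose i j) \<alpha>"
    using i j \<open>i \<noteq> j\<close> \<alpha>(2)
    by (intro nth_equalityI)
      (auto simp: permute_list_nth permutes_swap_id nth_list_update Transposition.transpose_def)
  finally show ?thesis .
qed

text \<open>Permutations are built from transpositions, and permuting keeps the set of occupied
  leaves, so \<open>w\<close> stays free throughout.\<close>

lemma star_permute:
  assumes G: "pair_graph G" and "1 \<le> s" and w: "(x, w) \<in> parcs G" "w \<notin> set \<alpha>"
    and \<alpha>: "distinct \<alpha>" "length \<alpha> = k" "set \<alpha> \<subseteq> {y. (x, y) \<in> parcs G}"
    and p: "p permutes {..<k}"
  shows "(\<alpha>, permute_list p \<alpha>) \<in> (parcs (labelled_supertoken_graph k s G))\<^sup>*"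
  using p finite_lessThan w(2) \<alpha>
proof (induction arbitrary: \<alpha> rule: permutes_induct)
  case id
  then show ?case by simp
next
  case (swap i j p)
  let ?\<beta> = "permute_list (Transposition.transpose i j) \<alpha>"
  have ij: "Transposition.transpose i j permutes {..<length \<alpha>}"
    using swap by (intro permutes_swap_id) auto
  have "(\<alpha>, ?\<beta>) \<in> (parcs (labelled_supertoken_graph k s G))\<^sup>*"
    using swap by (intro star_swap[OF G \<open>1 \<le> s\<close> _ _ _ _ _ _ w(1)]) auto
  also have "(?\<beta>, permute_list p ?\<beta>) \<in> (parcs (labelled_supertoken_graph k s G))\<^sup>*"
    using swap ij by (intro swap.IH) auto
  \<comment> \<open>\<open>permute_list\<close> reverses composition: the left factor acts first, so
    the swap precedes \<open>p\<close>, and the induction hypothesis is used at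
    \<open>?\<beta>\<close>.\<close>
  also have "permute_list p ?\<beta> = permute_list (Transposition.transpose i j \<circ> p) \<alpha>"
    using swap by (intro permute_list_compose[symmetric]) auto
  finally show ?case .
qed

section \<open>Maximum degree and connectedness for distinct tokens\<close>

lemma max_degree_attained:
  assumes "pair_graph G" and "pverts G \<noteq> {}"
  obtains x where "x \<in> pverts G" "card {y. (x, y) \<in> parcs G} = max_degree G"
proof -
  interpret pair_graph G by fact
  have "max_degree G \<in> out_degree (with_proj G) ` pverts G"
    unfolding max_degree_def using assms(2) by (intro Max_in) auto
  then obtain x where x: "x \<in> pverts G" "out_degree (with_proj G) x = max_degree G" by auto
  have "out_arcs (with_proj G) x = Pair x ` {y. (x, y) \<in> parcs G}"
    by (auto simp: out_arcs_def)
  with x have "card {y. (x, y) \<in> parcs G} = max_degree G"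
    by (simp add: out_degree_def card_image inj_on_def)
  with x show thesis using that by blast
qed

lemma connected_labelled_supertoken_graph:
  assumes G: "pair_graph G" and conn: "Digraph_Component.connected (with_proj G)"
    and s: "1 \<le> s" and k: "k < max_degree G"
  shows "Digraph_Component.connected (with_proj (labelled_supertoken_graph k s G))"
proof -
  interpret pair_graph G by fact
  let ?R = "(parcs (labelled_supertoken_graph k s G))\<^sup>*"
  have "pverts G \<noteq> {}" using conn by (simp add: connected_pair_graph_iff[OF G])
  with G obtain x where x: "x \<in> pverts G" "card {y. (x, y) \<in> parcs G} = max_degree G"
    by (rule max_degree_attained)
  then obtain N where N: "N \<subseteq> {y. (x, y) \<in> parcs G}" "card N = k" "finite N"
    using k obtain_subset_with_card_n[of k "{y. (x, y) \<in> parcs G}"] by auto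
  have NG: "N \<subseteq> pverts G" using N(1) in_arcsD2 by blast
  \<comment> \<open>The strict inequality \<open>k < max_degree G\<close> is what leaves the spare
    leaf \<open>w\<close> needed for swapping.\<close>
  have "N \<noteq> {y. (x, y) \<in> parcs G}" using N(2) x(2) k by auto
  then obtain w where w: "(x, w) \<in> parcs G" "w \<notin> N" using N(1) by blast
  have target: "mset_set N \<in> supertoken_verts k s G"
    using N NG s by (intro mset_set_in_supertoken_verts)
  have to_star: "\<exists>\<gamma>. mset \<gamma> = mset_set N \<and> (\<alpha>, \<gamma>) \<in> ?R"
    if "mset \<alpha> \<in> supertoken_verts k s G" for \<alpha>
    using supertoken_walk_lift[OF supertoken_verts_reachable[OF G conn that target]] by metis
  have "(\<alpha>, \<beta>) \<in> ?R"
    if \<alpha>: "mset \<alpha> \<in> supertoken_verts k s G" and \<beta>: "mset \<beta> \<in> supertoken_verts k s G" for \<alpha> \<beta>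
  proof -
    obtain \<gamma> where \<gamma>: "mset \<gamma> = mset_set N" "(\<alpha>, \<gamma>) \<in> ?R" using to_star[OF \<alpha>] by blast
    obtain \<delta> where \<delta>: "mset \<delta> = mset_set N" "(\<beta>, \<delta>) \<in> ?R" using to_star[OF \<beta>] by blast
    have set: "set \<gamma> = N" using \<gamma>(1) N(3) by (metis finite_set_mset_mset_set set_mset_mset)
    have len: "length \<gamma> = k" using \<gamma>(1) N(2) by (metis size_mset size_mset_set)
    \<comment> \<open>Both \<gamma> and \<delta> list the \<open>k\<close> elements of
      \<open>N\<close> once each, so they differ by a permutation; the walk from \<beta> to \<delta>
      is then reversed.\<close>
    have dist: "distinct \<gamma>" using set len N(2) by (simp add: card_distinct)
    obtain p where p: "p permutes {..<length \<gamma>}" "permute_list p \<gamma> = \<delta>"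
      using mset_eq_permutation[of \<delta> \<gamma>] \<gamma>(1) \<delta>(1) by metis
    have "(\<gamma>, \<delta>) \<in> ?R"
      using star_permute[OF G s w(1), of \<gamma> k p] w(2) set len dist N(1) p by simp
    moreover have "(\<delta>, \<beta>) \<in> ?R"
      using pair_graph_labelled_supertoken_graph[OF G] \<delta>(2) by (rule rtrancl_parcs_sym)
    ultimately show ?thesis using \<gamma>(2) by (meson rtrancl_trans)
  qed
  moreover have "pverts (labelled_supertoken_graph k s G) = {\<alpha>. mset \<alpha> \<in> supertoken_verts k s G}"
    by (auto simp: labelled_supertoken_graph_def labelled_supertoken_verts_iff)
  moreover obtain \<alpha> where "mset \<alpha> \<in> supertoken_verts k s G" using target ex_mset by metis
  ultimately show ?thesis
    unfolding connected_pair_graph_iff[OF pair_graph_labelled_supertoken_graph[OF G]]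
    by auto
qed

lemma max_degree_le_card:
  assumes "pair_graph G" and "pverts G \<noteq> {}"
  shows "max_degree G \<le> card (pverts G)"
proof -
  interpret pair_graph G by fact
  obtain x where "card {y. (x, y) \<in> parcs G} = max_degree G"
    using assms by (rule max_degree_attained)
  moreover have "card {y. (x, y) \<in> parcs G} \<le> card (pverts G)"
    using in_arcsD2 by (intro card_mono) auto
  ultimately show ?thesis by simp
qed

theorem theorem2p2:
  fixes G :: "'a pair_pre_digraph" and n k s :: nat
  assumes "pair_graph G"
    and "Digraph_Component.connected (with_proj G)"
    and "card (pverts G) = n"
    and "1 \<le> s" and "s \<le> k"
  shows "(k < max_degree G \<longrightarrow>
            Digraph_Component.connected (with_proj (supertoken_graph k s G)) \<and>
            Digraph_Component.connected (with_proj (labelled_supertoken_graph k s G))) \<and>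
         (max_degree G \<le> k \<and> k \<le> n \<and> (k, s) \<noteq> (n, 1) \<longrightarrow>
            Digraph_Component.connected (with_proj (supertoken_graph k s G)))"
proof -
  have "pverts G \<noteq> {}"
    using assms(1,2) by (simp add: connected_pair_graph_iff)
  \<comment> \<open>Hence \<open>k < max_degree G\<close> also yields \<open>k \<le> n\<close>, and
    \<open>connected_supertoken_graph\<close> serves both ranges of \<open>k\<close>.\<close>
  with assms(1,3) have "max_degree G \<le> n" using max_degree_le_card by blast
  then show ?thesis
    using assms connected_supertoken_graph connected_labelled_supertoken_graph by auto
qed

end
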